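(* Let $d\ge 1$ and $r\geq 0$, let $\gamma\in\mathbb S_d$ be a fixed involution, and fix $\sigma,\rho\in\mathbb S_d$ (starting and ending permutations). Then the number of tuples $(\gamma,\sigma,\tau_1,\dots,\tau_r)$ such that (1) $\tau_1,\dots,\tau_r\in\mathbb S_d$ are transpositions with $\tau_r\circ\cdots\circ\tau_1\circ\sigma=\rho$, (2) the subgroup generated by $\sigma,\tau_1,\dots,\tau_r$ acts transitively on $\{1,\dots,d\}$, and (3) $\gamma\circ\sigma\circ\gamma=\sigma^{-1}$ and $\gamma\circ(\tau_i\circ\cdots\circ\tau_1\circ\sigma)\circ\gamma=(\tau_i\circ\cdots\circ\tau_1\circ\sigma)^{-1}$ for all $i=1,\dots,r$, is equal to the number of walks $$\sigma'_0\xrightarrow{\tau_1}\sigma'_1\xrightarrow{\tau_2}\sigma'_2\cdots\xrightarrow{\tau_r}\sigma'_r$$ in the restricted Cayley graph from $\sigma'_0=\sigma\circ\gamma$ to $\sigma'_r=\rho\circ\gamma$ such that the subgroup generated by $\sigma,\tau_1,\dots,\tau_r$ acts transitively on $\{1,\dots,d\}$.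
   Context: An involution is an element $\gamma\in\mathbb S_d$ with $\gamma^2=\mathrm{id}$ (the identity is included). The (left) Cayley graph of $\mathbb S_d$ generated by all transpositions has vertex set $\mathbb S_d$ and an edge labelled $\tau$ from $\alpha$ to $\tau\circ\alpha$ for each $\alpha\in\mathbb S_d$ and each transposition $\tau$. The restricted Cayley graph is its induced subgraph whose vertices are exactly the involutions in $\mathbb S_d$. (If $\sigma\circ\gamma$ or $\rho\circ\gamma$ is not an involution, the number of walks is $0$.) The tuples described are those counted, for $\mu,\nu$ the cycle types of $\sigma,\rho$, in the symmetric group description of the real double Hurwitz number $\tilde H_g(\mu,\nu)$ with real positive branch points. *)

theory Defs
  imports
    "HOL-Algebra.Sym_Groups"
    "HOL-Algebra.Group_Action"
    "Graph_Theory.Arc_Walk"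
    "Graph_Theory.Digraph_Component"
begin

definition transpositions :: "nat \<Rightarrow> (nat \<Rightarrow> nat) set" where
  "transpositions d = {Transposition.transpose a b | a b. a \<in> {1..d} \<and> b \<in> {1..d} \<and> a \<noteq> b}"

definition involutions :: "nat \<Rightarrow> (nat \<Rightarrow> nat) set" where
  "involutions d = {\<gamma> \<in> carrier (sym_group d). \<gamma> \<circ> \<gamma> = id}"

text \<open>Elements of \<^const>\<open>sym_group\<close> are functions on all of \<^typ>\<open>nat\<close> fixing every point outside
  \<open>{1..d}\<close>, whereas \<^const>\<open>BijGroup\<close> consists of functions that are undefined outside the set;
  hence the restriction.\<close>

definition acts_transitively :: "nat \<Rightarrow> (nat \<Rightarrow> nat) set \<Rightarrow> bool" where
  "acts_transitively d S \<longleftrightarrow>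
     transitive_action (subgroup_generated (sym_group d) S) {1..d} (\<lambda>g. restrict g {1..d})"

text \<open>\<open>fold (\<circ>) [\<tau>\<^sub>1, \<dots>, \<tau>\<^sub>r] \<sigma>\<close> is \<open>\<tau>\<^sub>r \<circ> \<dots> \<circ> \<tau>\<^sub>1 \<circ> \<sigma>\<close>.\<close>

definition real_hurwitz_tuples ::
  "nat \<Rightarrow> nat \<Rightarrow> (nat \<Rightarrow> nat) \<Rightarrow> (nat \<Rightarrow> nat) \<Rightarrow> (nat \<Rightarrow> nat)
    \<Rightarrow> ((nat \<Rightarrow> nat) \<times> (nat \<Rightarrow> nat) \<times> (nat \<Rightarrow> nat) list) set" where
  "real_hurwitz_tuples d r \<gamma> \<sigma> \<rho> =
     {(\<gamma>, \<sigma>, \<tau>s) | \<tau>s. length \<tau>s = r \<and> set \<tau>s \<subseteq> transpositions d \<and>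
        fold (\<circ>) \<tau>s \<sigma> = \<rho> \<and>
        acts_transitively d (insert \<sigma> (set \<tau>s)) \<and>
        \<gamma> \<circ> \<sigma> \<circ> \<gamma> = inv' \<sigma> \<and>
        (\<forall>i\<in>{1..r}. \<gamma> \<circ> fold (\<circ>) (take i \<tau>s) \<sigma> \<circ> \<gamma> = inv' (fold (\<circ>) (take i \<tau>s) \<sigma>))}"

text \<open>The pair \<open>(\<alpha>, \<tau>)\<close> is the edge labelled \<open>\<tau>\<close> from \<open>\<alpha>\<close> to \<open>\<tau> \<circ> \<alpha>\<close>.\<close>

definition cayley_graph ::
  "nat \<Rightarrow> (nat \<Rightarrow> nat, (nat \<Rightarrow> nat) \<times> (nat \<Rightarrow> nat)) pre_digraph" where
  "cayley_graph d =
     \<lparr> verts = carrier (sym_group d),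
       arcs = carrier (sym_group d) \<times> transpositions d,
       tail = fst,
       head = (\<lambda>(\<alpha>, \<tau>). \<tau> \<circ> \<alpha>) \<rparr>"

definition restricted_cayley_graph ::
  "nat \<Rightarrow> (nat \<Rightarrow> nat, (nat \<Rightarrow> nat) \<times> (nat \<Rightarrow> nat)) pre_digraph" where
  "restricted_cayley_graph d = cayley_graph d \<restriction> involutions d"

definition transitive_walks ::
  "nat \<Rightarrow> nat \<Rightarrow> (nat \<Rightarrow> nat) \<Rightarrow> (nat \<Rightarrow> nat) \<Rightarrow> (nat \<Rightarrow> nat)
    \<Rightarrow> ((nat \<Rightarrow> nat) \<times> (nat \<Rightarrow> nat)) awalk set" where
  "transitive_walks d r \<gamma> \<sigma> \<rho> =
     {w. pre_digraph.awalk (restricted_cayley_graph d) (\<sigma> \<circ> \<gamma>) w (\<rho> \<circ> \<gamma>) \<and> length w = r \<and>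
         acts_transitively d (insert \<sigma> (set (map snd w)))}"

lemma acts_transitively_iff:
  assumes "S \<subseteq> carrier (sym_group d)"
  shows "acts_transitively d S \<longleftrightarrow>
    (\<forall>x\<in>{1..d}. \<forall>y\<in>{1..d}. \<exists>g\<in>generate (sym_group d) S. g x = y)"
proof -
  let ?G = "subgroup_generated (sym_group d) S" and ?\<phi> = "\<lambda>g. restrict g {1..d} :: nat \<Rightarrow> nat"
  have C: "carrier ?G = generate (sym_group d) S"
    using assms by (simp add: carrier_subgroup_generated Int_absorb1)
  have sub: "carrier ?G \<subseteq> carrier (sym_group d)"
    unfolding C by (rule group.generate_incl[OF sym_group_is_group assms])
  have bij: "?\<phi> g \<in> Bij {1..d}" if "g permutes {1..d}" for g
  proof -
    have "bij_betw (?\<phi> g) {1..d} {1..d}"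
      using permutes_imp_bij[OF that] bij_betw_cong[of "{1..d}" "?\<phi> g" g "{1..d}"]
      by (metis restrict_apply')
    then show ?thesis by (simp add: Bij_def)
  qed
  have "group_hom ?G (BijGroup {1..d}) ?\<phi>"
  proof (rule group_hom.intro)
    show "group ?G"
      by (rule group.group_subgroup_generated[OF sym_group_is_group])
    show "group (BijGroup {1..d})"
      by (rule group_BijGroup)
    show "group_hom_axioms ?G (BijGroup {1..d}) ?\<phi>"
    proof (unfold_locales, rule homI)
      fix g assume "g \<in> carrier ?G"
      then show "?\<phi> g \<in> carrier (BijGroup {1..d})"
        using sub bij by (auto simp: sym_group_carrier BijGroup_def)
    next
      fix g h assume "g \<in> carrier ?G" "h \<in> carrier ?G"
      then have p: "g permutes {1..d}" "h permutes {1..d}"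
        using sub by (auto simp: sym_group_carrier)
      have "?\<phi> (g \<circ> h) = compose {1..d} (?\<phi> g) (?\<phi> h)"
        using permutes_in_image[OF p(2)] by (auto simp: compose_def restrict_def fun_eq_iff)
      then show "?\<phi> (g \<otimes>\<^bsub>?G\<^esub> h) = ?\<phi> g \<otimes>\<^bsub>BijGroup {1..d}\<^esub> ?\<phi> h"
        using bij[OF p(1)] bij[OF p(2)] by (simp add: sym_group_mult BijGroup_def)
    qed
  qed
  then show ?thesis
    by (auto simp: acts_transitively_def transitive_action_def transitive_action_axioms_def
        group_action_def C)
qed

lemma finite_sym_group: "finite (carrier (sym_group d))"
  by (simp add: sym_group_def finite_permutations)

lemma finite_transpositions: "finite (transpositions d)"
proof -
  have "transpositions d \<subseteq> (\<lambda>(a, b). Transposition.transpose a b) ` ({1..d} \<times> {1..d})"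
    by (auto simp: transpositions_def)
  then show ?thesis by (rule finite_subset) simp
qed

lemma finite_real_hurwitz_tuples: "finite (real_hurwitz_tuples d r \<gamma> \<sigma> \<rho>)"
  by (rule finite_subset[where B = "{\<gamma>} \<times> {\<sigma>} \<times> {\<tau>s. set \<tau>s \<subseteq> transpositions d \<and> length \<tau>s = r}"])
     (auto simp: real_hurwitz_tuples_def finite_transpositions finite_lists_length_eq)

lemma finite_transitive_walks: "finite (transitive_walks d r \<gamma> \<sigma> \<rho>)"
proof (rule finite_subset)
  show "transitive_walks d r \<gamma> \<sigma> \<rho>
    \<subseteq> {w. set w \<subseteq> carrier (sym_group d) \<times> transpositions d \<and> length w = r}"
    by (auto simp: transitive_walks_def pre_digraph.awalk_def restricted_cayley_graph_def
        cayley_graph_def)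
  show "finite {w. set w \<subseteq> carrier (sym_group d) \<times> transpositions d \<and> length w = r}"
    by (simp add: finite_lists_length_eq finite_sym_group finite_transpositions)
qed

end

theory Submission
  imports Defs
begin

text \<open>Since \<open>\<gamma>\<close> is an involution, a permutation \<open>\<alpha>\<close> satisfies \<open>\<gamma> \<circ> \<alpha> \<circ> \<gamma> = \<alpha>\<inverse>\<close> exactly when
  \<open>\<alpha> \<circ> \<gamma>\<close> is an involution. Right multiplication by \<open>\<gamma>\<close> commutes with the left multiplications
  by the \<open>\<tau>\<^sub>i\<close>, so the conditions on a tuple say precisely that the walk from \<open>\<sigma> \<circ> \<gamma>\<close> with labels
  \<open>\<tau>\<^sub>1, \<dots>, \<tau>\<^sub>r\<close> stays among the involutions and ends at \<open>\<rho> \<circ> \<gamma>\<close>; and a walk with a given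
  starting point is determined by its labels.\<close>

text \<open>An arc is a pair of its tail and its label, so a walk stored as a list of arcs also
  records every vertex it leaves. This function restores those vertices from the start and the
  labels.\<close>

fun labelled_walk :: "('a \<Rightarrow> 'a) \<Rightarrow> ('a \<Rightarrow> 'a) list \<Rightarrow> (('a \<Rightarrow> 'a) \<times> ('a \<Rightarrow> 'a)) list" where
  "labelled_walk \<alpha> [] = []"
| "labelled_walk \<alpha> (\<tau> # \<tau>s) = (\<alpha>, \<tau>) # labelled_walk (\<tau> \<circ> \<alpha>) \<tau>s"

lemma map_snd_labelled_walk [simp]: "map snd (labelled_walk \<alpha> \<tau>s) = \<tau>s"
  by (induction \<tau>s arbitrary: \<alpha>) auto

lemma inj_labelled_walk: "inj (labelled_walk \<alpha>)"
  by (metis injI map_snd_labelled_walk)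

lemma all_le_Suc_iff: "(\<forall>i\<le>Suc n. P i) \<longleftrightarrow> P 0 \<and> (\<forall>i\<le>n. P (Suc i))"
  by (metis Suc_le_mono not0_implies_Suc zero_le)

text \<open>An arc survives in the induced subgraph only if both its ends are involutions. The index
  \<open>i = 0\<close> matters: even the empty walk must start at a vertex of the graph.\<close>

lemma awalk_restricted_cayley_graph_iff:
  "pre_digraph.awalk (restricted_cayley_graph d) \<alpha> w \<beta> \<longleftrightarrow>
     w = labelled_walk \<alpha> (map snd w) \<and> set (map snd w) \<subseteq> transpositions d \<and>
     fold (\<circ>) (map snd w) \<alpha> = \<beta> \<and>
     (\<forall>i\<le>length w. fold (\<circ>) (take i (map snd w)) \<alpha> \<in> involutions d)"
proof (induction w arbitrary: \<alpha>)
  case Nil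
  then show ?case
    by (auto simp: pre_digraph.awalk_def pre_digraph.cas.simps restricted_cayley_graph_def)
next
  case (Cons e w)
  obtain \<alpha>' \<tau> where e: "e = (\<alpha>', \<tau>)" by fastforce
  let ?G = "restricted_cayley_graph d"
  \<comment> \<open>That the head \<open>\<tau> \<circ> \<alpha>\<close> is an involution is implied
    by the last conjunct, since the remaining walk starts there.\<close>
  have "pre_digraph.awalk ?G \<alpha> (e # w) \<beta> \<longleftrightarrow>
      \<alpha>' = \<alpha> \<and> \<alpha> \<in> involutions d \<and> \<tau> \<in> transpositions d \<and> pre_digraph.awalk ?G (\<tau> \<circ> \<alpha>) w \<beta>"
    unfolding e
    by (auto simp: pre_digraph.awalk_def pre_digraph.cas.simps restricted_cayley_graph_def
        cayley_graph_def involutions_def)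
  then show ?case
    unfolding Cons.IH list.size add_0_right add_Suc_right all_le_Suc_iff e
    by (simp only: list.map snd_conv labelled_walk.simps list.inject prod.inject fold_simps
        take_0 take_Suc_Cons list.set insert_subset) blast
qed

lemma fold_comp_comp_right: "fold (\<circ>) \<tau>s (\<sigma> \<circ> \<gamma>) = fold (\<circ>) \<tau>s \<sigma> \<circ> \<gamma>"
  by (induction \<tau>s arbitrary: \<sigma>) (simp_all flip: comp_assoc)

lemma transpositions_subset_carrier: "transpositions d \<subseteq> carrier (sym_group d)"
  by (auto simp: transpositions_def sym_group_carrier simp del: One_nat_def intro!: permutes_swap_id)

lemma fold_comp_in_carrier:
  assumes "set \<tau>s \<subseteq> carrier (sym_group d)" "\<sigma> \<in> carrier (sym_group d)"
  shows "fold (\<circ>) \<tau>s \<sigma> \<in> carrier (sym_group d)"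
  using assms
  by (induction \<tau>s arbitrary: \<sigma>) (auto simp: sym_group_carrier permutes_compose)

text \<open>The square of \<open>\<alpha> \<circ> \<gamma>\<close> is \<open>\<alpha> \<circ>
  (\<gamma> \<circ> \<alpha> \<circ> \<gamma>)\<close>, and a right inverse of a permutation is its
  inverse.\<close>

lemma comp_in_involutions_iff:
  assumes \<gamma>: "\<gamma> \<in> involutions d" and \<alpha>: "\<alpha> \<in> carrier (sym_group d)"
  shows "\<alpha> \<circ> \<gamma> \<in> involutions d \<longleftrightarrow> \<gamma> \<circ> \<alpha> \<circ> \<gamma> = inv' \<alpha>"
proof -
  have p: "\<alpha> permutes {1..d}" "\<gamma> permutes {1..d}"
    using assms by (auto simp: involutions_def sym_group_carrier)
  have "\<alpha> \<circ> \<gamma> \<in> involutions d \<longleftrightarrow> \<alpha> \<circ> (\<gamma> \<circ> \<alpha> \<circ> \<gamma>) = id"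
    using permutes_compose[OF p(2,1)]
    by (simp add: involutions_def sym_group_carrier comp_assoc)
  also have "\<dots> \<longleftrightarrow> \<gamma> \<circ> \<alpha> \<circ> \<gamma> = inv' \<alpha>"
    using permutes_inv_o[OF p(1)] by (metis comp_assoc comp_id id_comp)
  finally show ?thesis .
qed

theorem theorem5p4:
  fixes d r :: nat and \<gamma> \<sigma> \<rho> :: "nat \<Rightarrow> nat"
  assumes "d \<ge> 1"
    and "\<gamma> \<in> involutions d"
    and "\<sigma> \<in> carrier (sym_group d)"
    and "\<rho> \<in> carrier (sym_group d)"
  shows "card (real_hurwitz_tuples d r \<gamma> \<sigma> \<rho>) = card (transitive_walks d r \<gamma> \<sigma> \<rho>)"
proof -
  \<comment> \<open>The label lists common to both sides: tuples and walks are both injective images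
    of \<open>L\<close>. Its last condition is phrased for walks.\<close>
  define L where "L = {\<tau>s. length \<tau>s = r \<and> set \<tau>s \<subseteq> transpositions d \<and> fold (\<circ>) \<tau>s \<sigma> = \<rho> \<and>
    acts_transitively d (insert \<sigma> (set \<tau>s)) \<and>
    (\<forall>i\<le>r. fold (\<circ>) (take i \<tau>s) (\<sigma> \<circ> \<gamma>) \<in> involutions d)}"
  have \<gamma>: "\<gamma> \<circ> \<gamma> = id"
    using assms(2) by (simp add: involutions_def)
  have cancel: "\<alpha> \<circ> \<gamma> = \<beta> \<circ> \<gamma> \<longleftrightarrow> \<alpha> = \<beta>" for \<alpha> \<beta> :: "nat \<Rightarrow> nat"
    by (metis \<gamma> comp_assoc comp_id)
  have involutions_iff: "fold (\<circ>) (take i \<tau>s) (\<sigma> \<circ> \<gamma>) \<in> involutions d \<longleftrightarrow>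
      \<gamma> \<circ> fold (\<circ>) (take i \<tau>s) \<sigma> \<circ> \<gamma> = inv' (fold (\<circ>) (take i \<tau>s) \<sigma>)"
    if "set \<tau>s \<subseteq> transpositions d" for i \<tau>s
  proof -
    have "set (take i \<tau>s) \<subseteq> carrier (sym_group d)"
      using set_take_subset[of i \<tau>s] that transpositions_subset_carrier by blast
    then show ?thesis
      using comp_in_involutions_iff[OF assms(2) fold_comp_in_carrier[OF _ assms(3)]]
      by (simp add: fold_comp_comp_right)
  qed
  \<comment> \<open>The vertex condition at \<open>i = 0\<close> is the separate condition on
    \<open>\<sigma>\<close> in the tuples.\<close>
  have split_le: "(\<forall>i\<le>r. P i) \<longleftrightarrow> P 0 \<and> (\<forall>i\<in>{1..r}. P i)" for P
    by (metis One_nat_def Suc_leI atLeastAtMost_iff bot_nat_0.extremum neq0_conv)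
  have "L = {\<tau>s. length \<tau>s = r \<and> set \<tau>s \<subseteq> transpositions d \<and> fold (\<circ>) \<tau>s \<sigma> = \<rho> \<and>
      acts_transitively d (insert \<sigma> (set \<tau>s)) \<and> \<gamma> \<circ> \<sigma> \<circ> \<gamma> = inv' \<sigma> \<and>
      (\<forall>i\<in>{1..r}. \<gamma> \<circ> fold (\<circ>) (take i \<tau>s) \<sigma> \<circ> \<gamma> = inv' (fold (\<circ>) (take i \<tau>s) \<sigma>))}"
    unfolding L_def split_le
    by (intro Collect_cong conj_cong refl)
      (simp_all only: involutions_iff take_0 fold_simps comp_in_involutions_iff[OF assms(2,3)])
  then have "real_hurwitz_tuples d r \<gamma> \<sigma> \<rho> = (\<lambda>\<tau>s. (\<gamma>, \<sigma>, \<tau>s)) ` L"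
    unfolding real_hurwitz_tuples_def by blast
  then have "card (real_hurwitz_tuples d r \<gamma> \<sigma> \<rho>) = card L"
    by (simp add: card_image inj_on_def)
  moreover have "transitive_walks d r \<gamma> \<sigma> \<rho> = labelled_walk (\<sigma> \<circ> \<gamma>) ` L"
  proof (intro equalityI subsetI)
    fix w assume "w \<in> transitive_walks d r \<gamma> \<sigma> \<rho>"
    \<comment> \<open>Cancelling \<open>\<gamma>\<close> turns the endpoint
      \<open>\<rho> \<circ> \<gamma>\<close> of the walk into the product condition with value
      \<open>\<rho>\<close>.\<close>
    then have "w = labelled_walk (\<sigma> \<circ> \<gamma>) (map snd w)" "map snd w \<in> L"
      by (auto simp: transitive_walks_def awalk_restricted_cayley_graph_iff L_def
          fold_comp_comp_right cancel)
    then show "w \<in> labelled_walk (\<sigma> \<circ> \<gamma>) ` L" by blast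
  next
    fix w assume "w \<in> labelled_walk (\<sigma> \<circ> \<gamma>) ` L"
    then obtain \<tau>s where \<tau>s: "w = labelled_walk (\<sigma> \<circ> \<gamma>) \<tau>s" "\<tau>s \<in> L" by blast
    then have "map snd w = \<tau>s" by simp
    moreover from this have "length w = length \<tau>s" by auto
    ultimately show "w \<in> transitive_walks d r \<gamma> \<sigma> \<rho>"
      using \<tau>s unfolding transitive_walks_def awalk_restricted_cayley_graph_iff L_def mem_Collect_eq
      by (simp add: fold_comp_comp_right)
  qed
  then have "card (transitive_walks d r \<gamma> \<sigma> \<rho>) = card L"
    by (simp add: card_image inj_on_subset[OF inj_labelled_walk])
  ultimately show ?thesis by simp
qed

end
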